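(* Let $d\ge2$, $2\le m\le d$, $\boldsymbol{x},\boldsymbol{y}\in\mathbb{R}^d$ and $z=\|\boldsymbol{x}-\boldsymbol{y}\|_2$. For the random Fourier feature estimator of $\exp(-\|\boldsymbol{x}-\boldsymbol{y}\|_2^2/2)$ with $m$ random vectors, the difference between the mean squared errors using IIDRFs and using ORFs is $$\mathrm{MSE}_{\mathrm{IIDRF}}-\mathrm{MSE}_{\mathrm{ORF}}=\frac{m-1}{m}\left(e^{-z^2}-\frac{\Gamma(d/2)}{\Gamma(d)}\sum_{k=0}^\infty\frac{(-z^2)^k}{2^kk!}\frac{\Gamma(k+d)}{\Gamma(k+d/2)}\right).$$
   Context: Random Fourier features: $\phi(\boldsymbol{z})=\frac{1}{\sqrt m}\big(\sin(\boldsymbol{w}_1^\top\boldsymbol{z}),\cos(\boldsymbol{w}_1^\top\boldsymbol{z}),\dots,\sin(\boldsymbol{w}_m^\top\boldsymbol{z}),\cos(\boldsymbol{w}_m^\top\boldsymbol{z})\big)^\top$, $\widehat K(\boldsymbol{x},\boldsymbol{y})=\phi(\boldsymbol{x})^\top\phi(\boldsymbol{y})=\frac1m\sum_i\cos(\boldsymbol{w}_i^\top(\boldsymbol{x}-\boldsymbol{y}))$, and $\mathrm{MSE}=\mathbb{E}[(\widehat K-\exp(-\|\boldsymbol{x}-\boldsymbol{y}\|_2^2/2))^2]$. IIDRFs: $\boldsymbol{w}_1,\dots,\boldsymbol{w}_m$ i.i.d. $\mathcal{N}(0,\mathbf{I}_d)$. ORFs: $\boldsymbol{w}_i$ ($i\le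 m$) are the first $m$ rows of $\mathrm{diag}(w_1,\dots,w_d)\mathbf{R}$ with $w_i$ i.i.d. $\chi_d$ and $\mathbf{R}$ Haar-distributed on $\mathrm{O}(d)$, independent. *)

theory Defs
  imports "HOL-Probability.Probability"
begin

definition std_gauss_vec :: "(real ^ 'd) measure" where
  "std_gauss_vec = density lborel (\<lambda>v. ennreal (\<Prod>j\<in>UNIV. std_normal_density (v $ j)))"

text \<open>The chi distribution with k degrees of freedom (law of the norm of a standard Gaussian in R^k).\<close>
definition chi_density :: "nat \<Rightarrow> real \<Rightarrow> real" where
  "chi_density k t = (if t > 0 then t ^ (k - 1) * exp (- t\<^sup>2 / 2) /
      (2 powr (real k / 2 - 1) * Gamma (real k / 2)) else 0)"

definition chi_measure :: "nat \<Rightarrow> real measure" where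
  "chi_measure k = density lborel (\<lambda>t. ennreal (chi_density k t))"

definition haar_orthogonal :: "(real ^ 'd ^ 'd) measure \<Rightarrow> bool" where
  "haar_orthogonal H \<longleftrightarrow> prob_space H \<and> sets H = sets borel \<and>
     emeasure H {Q. orthogonal_matrix Q} = 1 \<and>
     (\<forall>Q. orthogonal_matrix Q \<longrightarrow> distr H borel (\<lambda>A. Q ** A) = H)"

definition rff_est :: "'i set \<Rightarrow> ('i \<Rightarrow> real ^ 'd) \<Rightarrow> real ^ 'd \<Rightarrow> real ^ 'd \<Rightarrow> real" where
  "rff_est I w x y = (1 / real (card I)) * (\<Sum>i\<in>I. cos (w i \<bullet> (x - y)))"

definition mse_iid :: "'i set \<Rightarrow> real ^ 'd \<Rightarrow> real ^ 'd \<Rightarrow> real" where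
  "mse_iid I x y = (\<integral>w. (rff_est I w x y - exp (- (norm (x - y))\<^sup>2 / 2))\<^sup>2
       \<partial>(PiM I (\<lambda>_. (std_gauss_vec :: (real ^ 'd) measure))))"

text \<open>MSE with ORFs: the vectors are the rows indexed by I of diag(s) R, with
  s_j i.i.d. chi_d (j ranging over all d indices) and R Haar on O(d), independent.\<close>
definition mse_orf :: "(real ^ 'd ^ 'd) measure \<Rightarrow> 'd set \<Rightarrow> real ^ 'd \<Rightarrow> real ^ 'd \<Rightarrow> real" where
  "mse_orf H I x y = (\<integral>p. (rff_est I (\<lambda>i. fst p i *\<^sub>R (snd p $ i)) x y
        - exp (- (norm (x - y))\<^sup>2 / 2))\<^sup>2
       \<partial>(PiM (UNIV :: 'd set) (\<lambda>_. chi_measure CARD('d)) \<Otimes>\<^sub>M H))"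

end

theory Submission
  imports Defs
begin

text \<open>
  Writing v = x - y and u = R v, the ORF estimator only sees u, and left invariance of the Haar
  measure makes the law of the scalar product of u with a vector a depend on a only through its norm.
  Comparing the coefficients of b^2 in E (u_i + b u_j)^(2n+2) = (1 + b^2)^(n+1) E u_i^(2n+2) and summing
  over j yields a recursion for the even moments of u_i.
  By the same rotation argument s_i u_i + s_j u_j has the even moments of T u_1, where T^2 = s_i^2 + s_j^2
  is chi-squared with 2d degrees of freedom; integrating the cosine series termwise gives the
  cross terms of the ORF error. The diagonal and linear terms agree with the i.i.d. case because
  s_i u_i has the moments of a centred Gaussian of variance |v|^2.
\<close>

section \<open>Moments and cosine expectations\<close>

lemma summable_pow_even_over_fact:
  fixes x :: real
  shows "summable (\<lambda>n. x ^ (2 * n) / fact (2 * n))"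
proof (rule summable_comparison_test')
  show "summable (\<lambda>n. (x\<^sup>2) ^ n / fact n)"
    using summable_exp[of "x\<^sup>2"] by (simp add: field_simps)
  fix n :: nat
  have "(fact n :: real) \<le> fact (2 * n)"
    by (rule fact_mono) simp
  then show "norm (x ^ (2 * n) / fact (2 * n)) \<le> (x\<^sup>2) ^ n / fact n"
    by (auto simp: power_mult intro!: divide_left_mono)
qed

text \<open>All exponents are even, so taking norms of the terms of the cosine series only removes
  the signs. Summability of \<open>\<mu> n / fact (2 * n)\<close> is therefore the absolute
  convergence that termwise integration requires. Variables with the same even moments thus have the
  same expected cosine, and their laws need not be identified.\<close>

lemma expectation_cos_sums:
  fixes X :: "'a \<Rightarrow> real"
  assumes mom: "\<And>n. has_bochner_integral M (\<lambda>w. X w ^ (2 * n)) (\<mu> n)"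
    and sm: "summable (\<lambda>n. \<mu> n / fact (2 * n))"
  shows "(\<lambda>n. (- 1) ^ n * \<mu> n / fact (2 * n)) sums (\<integral>w. cos (X w) \<partial>M)"
proof -
  define f where "f n w = (- 1) ^ n / fact (2 * n) * X w ^ (2 * n)" for n w
  have I: "has_bochner_integral M (f n) ((- 1) ^ n * \<mu> n / fact (2 * n))" for n
    using has_bochner_integral_mult_right[OF mom[of n], of "(- 1) ^ n / fact (2 * n)"]
    unfolding f_def by simp
  have nf: "norm (f n w) = X w ^ (2 * n) / fact (2 * n)" for n w
    by (simp add: f_def power_mult abs_mult)
  have J: "has_bochner_integral M (\<lambda>w. norm (f n w)) (\<mu> n / fact (2 * n))" for n
    unfolding nf using has_bochner_integral_divide_zero[OF mom[of n], of "fact (2 * n)"] by simp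
  have "(\<lambda>n. integral\<^sup>L M (f n)) sums (\<integral>w. (\<Sum>n. f n w) \<partial>M)"
  proof (rule sums_integral)
    show "integrable M (f n)" for n using I by (auto simp: has_bochner_integral_iff)
    show "AE w in M. summable (\<lambda>n. norm (f n w))"
      unfolding nf by (simp add: summable_pow_even_over_fact)
    show "summable (\<lambda>n. \<integral>w. norm (f n w) \<partial>M)"
      using sm by (simp only: has_bochner_integral_integral_eq[OF J])
  qed
  moreover have "(\<Sum>n. f n w) = cos (X w)" for w
    using cos_paired[of "X w"] unfolding f_def by (simp add: sums_iff)
  ultimately show ?thesis
    by (simp only: has_bochner_integral_integral_eq[OF I])
qed

text \<open>Merges the half-line Gaussian moments of even and odd order, known in factorial form,
  into one Gamma expression. This lets the chi density be treated without a case split on the parity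
  of its degrees of freedom.\<close>

lemma gaussian_half_moment:
  "has_bochner_integral lborel (\<lambda>x::real. indicator {0..} x *\<^sub>R (exp (- x\<^sup>2) * x ^ p))
     (Gamma (real (p + 1) / 2) / 2)"
proof (cases "even p")
  case True
  then obtain k where p: "p = 2 * k" by blast
  have "Gamma (1 / 2 + real k) = pochhammer (1 / 2) k * sqrt pi"
    using pochhammer_Gamma[of "1 / 2 :: real" k] nonpos_Ints_nonpos[of "1 / 2 :: real"]
    by (force simp: Gamma_one_half_real field_simps)
  moreover have "(fact (2 * k) :: real) = 2 ^ (2 * k) * pochhammer (1 / 2) k * fact k"
    by (rule fact_double)
  ultimately have "Gamma (real k + 1 / 2) = sqrt pi * (fact (2 * k) / (2 ^ (2 * k) * fact k))"
    by (simp add: add.commute)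
  with gaussian_moment_even_pos[of k] show ?thesis
    unfolding p by (simp add: add_divide_distrib add.commute mult.commute[of 2])
next
  case False
  then obtain k where p: "p = 2 * k + 1" by (rule oddE)
  have "real (p + 1) / 2 = 1 + real k" unfolding p by simp
  then have "Gamma (real (p + 1) / 2) = fact k" by (metis Gamma_fact)
  then show ?thesis using gaussian_moment_odd_pos[of k] unfolding p by simp
qed

section \<open>The chi distribution and standard Gaussian vectors\<close>

lemma sets_chi_measure [measurable_cong, simp]: "sets (chi_measure k) = sets borel"
  by (simp add: chi_measure_def)

text \<open>These are the moments of a chi-squared variable with \<open>k\<close> degrees of
  freedom. The substitution t = sqrt 2 * u turns each into a half-line Gaussian moment of order
  \<open>p\<close>, the power of t in the density times t^(2n).\<close>

lemma chi_moment:
  assumes "k > 0"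
  shows "has_bochner_integral (chi_measure k) (\<lambda>t. t ^ (2 * n)) (2 ^ n * pochhammer (real k / 2) n)"
proof -
  define p where "p = k - 1 + 2 * n"
  define C where "C = 2 powr (real k / 2 - 1) * Gamma (real k / 2)"
  have chi: "chi_density k x = (if x > 0 then x ^ (k - 1) * exp (- x\<^sup>2 / 2) / C else 0)" for x
    unfolding chi_density_def C_def ..
  have G: "Gamma (real k / 2) > 0" using assms by (simp add: Gamma_real_pos)
  have "has_bochner_integral lborel (\<lambda>x::real. indicator {0..} (0 + inverse (sqrt 2) * x) *\<^sub>R
      (exp (- (0 + inverse (sqrt 2) * x)\<^sup>2) * (0 + inverse (sqrt 2) * x) ^ p))
     ((Gamma (real (p + 1) / 2) / 2) /\<^sub>R \<bar>inverse (sqrt 2)\<bar>)"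
    by (subst lborel_has_bochner_integral_real_affine_iff[symmetric, where c = "inverse (sqrt 2)" and t = 0])
       (use gaussian_half_moment[of p] in auto)
  then have "has_bochner_integral lborel (\<lambda>x::real. sqrt 2 ^ p / C * (indicator {0..} (inverse (sqrt 2) * x) *\<^sub>R
      (exp (- (inverse (sqrt 2) * x)\<^sup>2) * (inverse (sqrt 2) * x) ^ p)))
     (sqrt 2 ^ p / C * (Gamma (real (p + 1) / 2) / 2 * sqrt 2))"
    by (intro has_bochner_integral_mult_right) (simp add: mult.commute)
  moreover have "sqrt 2 ^ p / C * (Gamma (real (p + 1) / 2) / 2 * sqrt 2) = 2 ^ n * pochhammer (real k / 2) n"
  proof -
    have kk: "real k / 2 \<notin> \<int>\<^sub>\<le>\<^sub>0" using assms by (auto elim!: nonpos_Ints_cases simp: field_simps)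
    have a: "real (p + 1) / 2 = real k / 2 + real n" using assms by (simp add: p_def field_simps of_nat_diff)
    have g: "Gamma (real k / 2 + real n) = pochhammer (real k / 2) n * Gamma (real k / 2)"
      using pochhammer_Gamma[OF kk, of n] G by (simp add: field_simps)
    have "sqrt 2 / 2 = inverse (sqrt 2)" by (simp add: field_simps)
    \<comment> \<open>Bookkeeping of powers of 2: \<open>sqrt 2 ^ p\<close> undoes the rescaling of
      t^p, the next \<open>sqrt 2\<close> is the Jacobian, and the 1/2 comes from the Gaussian
      moment. As p - 1 = 2n + k - 2, the total is 2^n times the power of 2 in the normalising
      constant \<open>C\<close>.\<close>
    then have "sqrt 2 ^ p * sqrt 2 / 2 = sqrt 2 powr (real p - 1)"
      by (simp add: powr_diff powr_realpow field_simps)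
    also have "\<dots> = 2 powr ((real p - 1) / 2)"
      by (simp add: powr_half_sqrt[symmetric] powr_powr)
    also have "(real p - 1) / 2 = real n + (real k / 2 - 1)"
      using assms by (simp add: p_def field_simps of_nat_diff)
    also have "2 powr \<dots> = 2 ^ n * 2 powr (real k / 2 - 1)"
      by (simp add: powr_add powr_realpow)
    finally have s: "sqrt 2 ^ p * sqrt 2 / 2 = 2 ^ n * 2 powr (real k / 2 - 1)" .
    have "sqrt 2 ^ p / C * (Gamma (real (p + 1) / 2) / 2 * sqrt 2) =
      (sqrt 2 ^ p * sqrt 2 / 2) * Gamma (real (p + 1) / 2) / C" by (simp add: mult_ac)
    then show ?thesis unfolding s a g C_def using G by (simp add: field_simps)
  qed
  ultimately have *: "has_bochner_integral lborel (\<lambda>x::real. sqrt 2 ^ p / C * (indicator {0..} (inverse (sqrt 2) * x) *\<^sub>R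
      (exp (- (inverse (sqrt 2) * x)\<^sup>2) * (inverse (sqrt 2) * x) ^ p))) (2 ^ n * pochhammer (real k / 2) n)"
    by simp
  \<comment> \<open>The two integrands can differ only at 0, which \<open>indicator {0..}\<close>
    includes while \<open>chi_density\<close> vanishes there; for k = 1 and n = 0 they do
    differ.\<close>
  have ae: "AE x in lborel. sqrt 2 ^ p / C * (indicator {0..} (inverse (sqrt 2) * x) *\<^sub>R
      (exp (- (inverse (sqrt 2) * x)\<^sup>2) * (inverse (sqrt 2) * x) ^ p)) = chi_density k x *\<^sub>R x ^ (2 * n)"
  proof (rule AE_mp[OF AE_lborel_singleton[of 0]], rule AE_I2, rule impI)
    fix x :: real assume "x \<noteq> 0"
    then show "sqrt 2 ^ p / C * (indicator {0..} (inverse (sqrt 2) * x) *\<^sub>R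
      (exp (- (inverse (sqrt 2) * x)\<^sup>2) * (inverse (sqrt 2) * x) ^ p)) = chi_density k x *\<^sub>R x ^ (2 * n)"
      by (auto simp: chi p_def power_add power_mult_distrib zero_le_mult_iff
          indicator_def field_simps)
  qed
  have [measurable]: "chi_density k \<in> borel_measurable borel"
    unfolding chi_density_def by measurable
  have nn: "AE x in lborel. 0 \<le> chi_density k x"
    using G by (auto simp: chi_density_def)
  have "has_bochner_integral lborel (\<lambda>x. chi_density k x *\<^sub>R x ^ (2 * n)) (2 ^ n * pochhammer (real k / 2) n)"
    using * by (rule has_bochner_integralI_AE) (use ae in auto)
  then show ?thesis
    unfolding chi_measure_def
    by (intro has_bochner_integral_density) (use nn in auto)
qed

lemma prob_space_chi_measure:
  assumes "k > 0"
  shows "prob_space (chi_measure k)"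
proof
  have "integrable (chi_measure k) (\<lambda>_. 1::real)" "(\<integral>_. (1::real) \<partial>chi_measure k) = 1"
    using chi_moment[OF assms, of 0] by (auto simp: has_bochner_integral_iff)
  then have "(\<integral>\<^sup>+_. ennreal 1 \<partial>chi_measure k) = ennreal 1"
    by (subst nn_integral_eq_integral) auto
  then show "emeasure (chi_measure k) (space (chi_measure k)) = 1" by simp
qed

text \<open>Both the density and the complex exponential factor over an orthonormal basis, which
  reduces the claim to the one-dimensional characteristic function. The cosine itself does not
  factor, so it is obtained afterwards as a real part.\<close>

lemma has_bochner_integral_cis_std_gauss_vec:
  fixes v :: "real ^ 'd"
  shows "has_bochner_integral std_gauss_vec (\<lambda>g. cis (g \<bullet> v)) (of_real (exp (- (norm v)\<^sup>2 / 2)))"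
proof -
  interpret product_sigma_finite "\<lambda>_ :: real ^ 'd. lborel :: real measure" ..
  interpret N: real_distribution std_normal_distribution by (rule real_dist_normal_dist)
  have B: "(Basis :: (real ^ 'd) set) = range (\<lambda>j. axis j 1)"
    by (auto simp: Basis_vec_def)
  \<comment> \<open>Re-indexing by \<open>Basis\<close> matches \<open>lborel_eq\<close>, which
    presents \<open>lborel\<close> as the image of a product measure over
    \<open>Basis\<close>.\<close>
  have dens: "(\<Prod>j\<in>UNIV. std_normal_density (g $ j)) = (\<Prod>b\<in>Basis. std_normal_density (g \<bullet> b))"
    for g :: "real ^ 'd"
    unfolding B by (subst prod.reindex) (auto simp: inj_on_def axis_eq_axis inner_axis)
  define F where "F b t = complex_of_real (std_normal_density t) * cis (t * (b \<bullet> v))" for b t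
  have F: "has_bochner_integral lborel (F b) (of_real (exp (- (b \<bullet> v)\<^sup>2 / 2)))" for b
  proof -
    have "integrable std_normal_distribution (\<lambda>t. cis (t * (b \<bullet> v)))"
      by (rule N.integrable_const_bound[of _ 1]) (auto simp: cis_conv_exp)
    moreover have "(\<integral>t. cis (t * (b \<bullet> v)) \<partial>std_normal_distribution) = of_real (exp (- (b \<bullet> v)\<^sup>2 / 2))"
      using fun_cong[OF char_std_normal_distribution, of "b \<bullet> v"]
      unfolding char_def by (simp add: cis_conv_exp mult.commute)
    ultimately have "has_bochner_integral std_normal_distribution (\<lambda>t. cis (t * (b \<bullet> v))) (of_real (exp (- (b \<bullet> v)\<^sup>2 / 2)))"
      unfolding has_bochner_integral_iff by blast
    moreover have "(\<lambda>t. cis (t * (b \<bullet> v))) \<in> borel_measurable borel"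
      unfolding cis_conv_exp by measurable
    ultimately show ?thesis
      unfolding has_bochner_integral_iff F_def
      by (simp add: integrable_density integral_density scaleR_conv_of_real)
  qed
  have iF: "integrable lborel (F b)" and eF: "integral\<^sup>L lborel (F b) = of_real (exp (- (b \<bullet> v)\<^sup>2 / 2))" for b
    using F[of b] by (auto simp: has_bochner_integral_iff)
  have split: "(\<Prod>j\<in>UNIV. std_normal_density (g $ j)) *\<^sub>R cis (g \<bullet> v) = (\<Prod>b\<in>Basis. F b (g \<bullet> b))"
    for g :: "real ^ 'd"
  proof -
    have "cis (g \<bullet> v) = (\<Prod>b\<in>Basis. cis ((g \<bullet> b) * (b \<bullet> v)))"
      by (subst euclidean_inner)
         (simp add: cis_conv_exp sum_distrib_left inner_commute flip: exp_sum)
    then show ?thesis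
      unfolding dens F_def by (simp add: scaleR_conv_of_real prod.distrib)
  qed
  have Fm[measurable]: "F b \<in> borel_measurable borel" for b
    using iF[of b] by (simp add: borel_measurable_integrable)
  have "has_bochner_integral lborel (\<lambda>g::real ^ 'd. \<Prod>b\<in>Basis. F b (g \<bullet> b)) (\<Prod>b\<in>Basis. of_real (exp (- (b \<bullet> v)\<^sup>2 / 2)))"
    unfolding lborel_eq[where 'a="real ^ 'd"] has_bochner_integral_iff
    using product_integral_prod[of Basis F] product_integrable_prod[of Basis F]
    by (auto simp: iF eF integral_distr integrable_distr_eq cong: prod.cong)
  also have "(\<Prod>b\<in>Basis. complex_of_real (exp (- (b \<bullet> v)\<^sup>2 / 2))) = of_real (exp (- (norm v)\<^sup>2 / 2))"
  proof -
    have "(norm v)\<^sup>2 = (\<Sum>b\<in>Basis. (b \<bullet> v)\<^sup>2)"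
      unfolding power2_norm_eq_inner by (subst euclidean_inner) (simp add: inner_commute power2_eq_square)
    then show ?thesis
      by (simp flip: of_real_prod exp_sum sum_divide_distrib add: sum_negf)
  qed
  finally show ?thesis
    unfolding std_gauss_vec_def
    by (intro has_bochner_integral_density)
       (auto simp: split intro!: prod_nonneg borel_measurable_continuous_onI continuous_intros)
qed

lemma has_bochner_integral_cos_std_gauss_vec:
  "has_bochner_integral std_gauss_vec (\<lambda>g. cos (g \<bullet> v)) (exp (- (norm v)\<^sup>2 / 2))"
  using has_bochner_integral_Re[OF has_bochner_integral_cis_std_gauss_vec[of v]] by simp

text \<open>The total mass is the expected cosine at the zero vector.\<close>

lemma prob_space_std_gauss_vec: "prob_space (std_gauss_vec :: (real ^ 'd) measure)"
proof
  have "integrable (std_gauss_vec :: (real ^ 'd) measure) (\<lambda>_. 1::real)"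
    "(\<integral>_. (1::real) \<partial>(std_gauss_vec :: (real ^ 'd) measure)) = 1"
    using has_bochner_integral_cos_std_gauss_vec[of "0 :: real ^ 'd"] by (auto simp: has_bochner_integral_iff)
  then have "(\<integral>\<^sup>+_. ennreal 1 \<partial>(std_gauss_vec :: (real ^ 'd) measure)) = ennreal 1"
    by (subst nn_integral_eq_integral) auto
  then show "emeasure std_gauss_vec (space (std_gauss_vec :: (real ^ 'd) measure)) = 1" by simp
qed

section \<open>Rows of a Haar distributed orthogonal matrix\<close>

locale haar =
  fixes H :: "(real ^ 'd ^ 'd) measure"
  assumes haar_orthogonal: "haar_orthogonal H"
begin

sublocale prob_space H
  using haar_orthogonal by (simp add: haar_orthogonal_def)

lemma sets_H [measurable_cong]: "sets H = sets borel"
  using haar_orthogonal by (simp add: haar_orthogonal_def)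

lemma measurable_row_inner [measurable]: "(\<lambda>A. A $ i \<bullet> v) \<in> borel_measurable H"
proof -
  have "(\<lambda>A::real ^ 'd ^ 'd. A $ i \<bullet> v) \<in> borel_measurable borel"
    by (intro borel_measurable_continuous_onI continuous_intros)
  then show ?thesis by (simp add: measurable_cong_sets[OF sets_H refl])
qed

lemma AE_norm: "AE A in H. norm (A *v v) = norm v"
proof -
  have e: "emeasure H {Q. orthogonal_matrix Q} = 1"
    using haar_orthogonal by (simp add: haar_orthogonal_def)
  \<comment> \<open>A set outside \<open>sets H\<close> would have \<open>emeasure\<close> 0, not 1,
    so measurability comes for free.\<close>
  have "{Q :: real ^ 'd ^ 'd. orthogonal_matrix Q} \<in> sets H"
    using e emeasure_notin_sets by force
  then have "AE A in H. orthogonal_matrix A"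
    using e AE_in_set_eq_1[of "{Q. orthogonal_matrix Q}"] by (simp add: emeasure_eq_measure)
  then show ?thesis
    by eventually_elim
       (metis orthogonal_transformation_matrix orthogonal_transformation_norm
         matrix_of_matrix_vector_mul matrix_vector_mul_linear)
qed

lemma left_invariant:
  assumes Q: "orthogonal_matrix Q" and [measurable]: "h \<in> borel_measurable borel"
  shows "(\<integral>A. h (Q ** A) \<partial>H) = (\<integral>A. h A \<partial>H :: real)"
proof -
  have D: "distr H borel (\<lambda>A. Q ** A) = H"
    using haar_orthogonal Q by (simp add: haar_orthogonal_def)
  have "(\<lambda>A. Q ** A) \<in> borel_measurable borel"
    unfolding matrix_matrix_mult_def
    by (intro borel_measurable_continuous_onI continuous_intros)
  then have m: "(\<lambda>A. Q ** A) \<in> measurable H borel"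
    by (simp add: measurable_cong_sets[OF sets_H refl])
  have "(\<integral>A. h A \<partial>H) = (\<integral>A. h A \<partial>(distr H borel (\<lambda>A. Q ** A)))" by (simp add: D)
  also have "\<dots> = (\<integral>A. h (Q ** A) \<partial>H)" using m by (rule integral_distr) simp
  finally show ?thesis by simp
qed

text \<open>Choose an orthogonal \<open>Q\<close> that sends \<open>a\<close> to
  \<open>norm a\<close> times the basis vector \<open>axis i 1\<close>. Since \<open>Q\<close>
  preserves inner products, a \<bullet> Av equals \<open>norm a\<close> times row \<open>i\<close>
  of \<open>Q ** A\<close> paired with \<open>v\<close>, and left invariance replaces
  \<open>Q ** A\<close> by \<open>A\<close>.\<close>

lemma expectation_inner:
  assumes h[measurable]: "h \<in> borel_measurable borel"
  shows "(\<integral>A. h (a \<bullet> (A *v v)) \<partial>H) = (\<integral>A. h (norm a * (A $ i \<bullet> v)) \<partial>H :: real)"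
proof -
  have "norm a = norm (norm a *\<^sub>R axis i (1::real))" by simp
  then obtain f where f: "orthogonal_transformation f" "f a = norm a *\<^sub>R axis i (1::real)"
    by (rule orthogonal_transformation_exists)
  define Q where "Q = matrix f"
  have Q: "orthogonal_matrix Q" and fQ: "f x = Q *v x" for x
    using f(1) unfolding Q_def orthogonal_transformation_matrix by (auto simp: matrix_works)
  have "norm a * ((Q ** A) $ i \<bullet> v) = a \<bullet> (A *v v)" for A
  proof -
    have "norm a * ((Q ** A) $ i \<bullet> v) = f a \<bullet> ((Q ** A) *v v)"
      by (simp add: f(2) inner_axis' matrix_vector_mul_component)
    also have "\<dots> = f a \<bullet> f (A *v v)"
      by (simp add: fQ matrix_vector_mul_assoc)
    also have "\<dots> = a \<bullet> (A *v v)"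
      using f(1) by (simp add: orthogonal_transformation_def)
    finally show ?thesis .
  qed
  moreover have "(\<lambda>A. h (norm a * (A $ i \<bullet> v))) \<in> borel_measurable borel"
  proof -
    have "(\<lambda>A::real ^ 'd ^ 'd. A $ i \<bullet> v) \<in> borel_measurable borel"
      by (intro borel_measurable_continuous_onI continuous_intros)
    then show ?thesis by measurable
  qed
  ultimately show ?thesis
    using left_invariant[OF Q, of "\<lambda>A. h (norm a * (A $ i \<bullet> v))"] by simp
qed

lemma AE_row_inner_le: "AE A in H. \<bar>A $ i \<bullet> v\<bar> \<le> norm v"
  using AE_norm[of v]
proof eventually_elim
  case (elim A)
  then show ?case using component_le_norm_cart[of "A *v v" i] by (simp add: matrix_vector_mul_component)
qed

section \<open>Even moments of one coordinate of the rotated vector\<close>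

lemma integrable_row_inner_powers:
  "integrable H (\<lambda>A. (A $ i \<bullet> v) ^ p * (A $ j \<bullet> v) ^ q)"
proof (rule integrable_const_bound)
  show "AE A in H. norm ((A $ i \<bullet> v) ^ p * (A $ j \<bullet> v) ^ q) \<le> norm v ^ p * norm v ^ q"
    using AE_row_inner_le[of i v] AE_row_inner_le[of j v]
    by eventually_elim (auto simp: abs_mult power_abs intro!: mult_mono power_mono)
qed measurable

text \<open>A moment of one coordinate of a uniform random point on the sphere of radius
  \<open>norm v\<close>.\<close>

definition row_moment :: "nat \<Rightarrow> 'd \<Rightarrow> real ^ 'd \<Rightarrow> real" where
  "row_moment n i v = (\<integral>A. (A $ i \<bullet> v) ^ n \<partial>H)"

lemma integrable_row_inner_power: "integrable H (\<lambda>A. (A $ i \<bullet> v) ^ p)"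
  using integrable_row_inner_powers[of i v p i 0] by simp

text \<open>The combination is the inner product of Av with a vector supported on coordinates
  \<open>i\<close> and \<open>j\<close>, of squared norm a^2 + b^2. Rotation invariance then allows
  any reference row \<open>k\<close>.\<close>

lemma row_moment_combination:
  assumes "i \<noteq> j"
  shows "(\<integral>A. (a * (A $ i \<bullet> v) + b * (A $ j \<bullet> v)) ^ (2 * n) \<partial>H) = (a\<^sup>2 + b\<^sup>2) ^ n * row_moment (2 * n) k v"
proof -
  define w where "w = a *\<^sub>R axis i (1::real) + b *\<^sub>R axis j 1"
  have "(norm w)\<^sup>2 = a\<^sup>2 + b\<^sup>2"
    unfolding w_def power2_norm_eq_inner
    using assms by (simp add: inner_add inner_axis_axis power2_eq_square)
  then have n: "norm w ^ (2 * n) = (a\<^sup>2 + b\<^sup>2) ^ n" by (simp add: power_mult)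
  have "w \<bullet> (A *v v) = a * (A $ i \<bullet> v) + b * (A $ j \<bullet> v)" for A
    by (simp add: w_def inner_add_left inner_axis' matrix_vector_mul_component)
  then have "(\<integral>A. (a * (A $ i \<bullet> v) + b * (A $ j \<bullet> v)) ^ (2 * n) \<partial>H)
      = (\<integral>A. (norm w * (A $ k \<bullet> v)) ^ (2 * n) \<partial>H)"
    using expectation_inner[of "\<lambda>x. x ^ (2 * n)" w v k] by simp
  also have "\<dots> = (a\<^sup>2 + b\<^sup>2) ^ n * row_moment (2 * n) k v"
    by (simp add: power_mult_distrib n row_moment_def)
  finally show ?thesis .
qed

text \<open>Compares the coefficients of b^2 in the expectation of (u_i + b u_j)^(2n+2), expanded
  binomially and evaluated by rotation invariance. The common factor n + 1 cancels because (2n+2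
  choose 2) = (n+1)(2n+1).\<close>

lemma row_mixed_moment:
  assumes "i \<noteq> j"
  shows "real (2 * n + 1) * (\<integral>A. (A $ i \<bullet> v) ^ (2 * n) * (A $ j \<bullet> v)\<^sup>2 \<partial>H) = row_moment (2 * Suc n) i v"
proof -
  define N where "N = 2 * Suc n"
  define c where "c k = real (N choose k) * (\<integral>A. (A $ j \<bullet> v) ^ k * (A $ i \<bullet> v) ^ (N - k) \<partial>H)" for k
  define P where "P = (\<Sum>k\<le>N. monom (c k) k)"
  define R where "R = smult (row_moment N i v) ([:1, 0, 1:] ^ Suc n)"
  \<comment> \<open>Agreement at every real \<open>b\<close> makes the polynomials identical, which
    justifies comparing single coefficients.\<close>
  have "poly P b = poly R b" for b
  proof -
    have "poly P b = (\<Sum>k\<le>N. \<integral>A. real (N choose k) * (b * (A $ j \<bullet> v)) ^ k * (A $ i \<bullet> v) ^ (N - k) \<partial>H)"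
      unfolding P_def c_def by (simp add: poly_sum poly_monom power_mult_distrib mult_ac)
    also have "\<dots> = (\<integral>A. (\<Sum>k\<le>N. real (N choose k) * (b * (A $ j \<bullet> v)) ^ k * (A $ i \<bullet> v) ^ (N - k)) \<partial>H)"
      by (rule Bochner_Integration.integral_sum[symmetric])
         (simp add: power_mult_distrib mult.assoc integrable_row_inner_powers)
    also have "\<dots> = (\<integral>A. (b * (A $ j \<bullet> v) + 1 * (A $ i \<bullet> v)) ^ N \<partial>H)"
      by (simp add: binomial_ring)
    also have "\<dots> = (b\<^sup>2 + 1) ^ Suc n * row_moment N i v"
      unfolding N_def using assms by (subst row_moment_combination[of _ _ _ _ _ _ i]) auto
    also have "\<dots> = poly R b"
      by (simp add: R_def poly_power power2_eq_square add.commute del: power_Suc)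
    finally show ?thesis .
  qed
  then have "P = R" by (intro poly_eq_poly_eq_iff[THEN iffD1] ext)
  then have eq: "coeff P 2 = coeff R 2" by simp
  have "coeff P 2 = c 2"
    unfolding P_def coeff_sum coeff_monom by (subst sum.delta) (auto simp: N_def)
  \<comment> \<open>The lower coefficients strengthen the induction, since the coefficient of b^2 in
    a product draws on them.\<close>
  moreover have "coeff ([:1, 0, 1:] ^ m) 0 = (1::real) \<and> coeff ([:1, 0, 1:] ^ m) 1 = (0::real)
      \<and> coeff ([:1, 0, 1:] ^ m) 2 = real m" for m
    by (induction m) (auto simp: coeff_mult numeral_2_eq_2)
  then have "coeff R 2 = real (Suc n) * row_moment N i v"
    unfolding R_def by (simp del: power_Suc)
  moreover have "real (N choose 2) = real (Suc n) * real (2 * n + 1)"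
    unfolding N_def choose_two by (simp add: algebra_simps)
  ultimately show ?thesis
    using eq unfolding c_def by (simp add: N_def mult.commute)
qed

text \<open>Evaluates \<open>S\<close> twice: by \<open>row_mixed_moment\<close> as d - 1 equal
  terms, and by replacing the sum of the other squared coordinates with |v|^2 - u_i^2, as A
  preserves norms almost surely.\<close>

lemma row_moment_Suc:
  "(real CARD('d) + 2 * real n) * row_moment (2 * Suc n) i v
     = (2 * real n + 1) * (norm v)\<^sup>2 * row_moment (2 * n) i v"
proof -
  define S where "S = (\<Sum>j\<in>UNIV - {i}. \<integral>A. (A $ i \<bullet> v) ^ (2 * n) * (A $ j \<bullet> v)\<^sup>2 \<partial>H)"
  have "(2 * real n + 1) * S = (\<Sum>j\<in>UNIV - {i}. row_moment (2 * Suc n) i v)"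
    unfolding S_def sum_distrib_left
  proof (rule sum.cong[OF refl])
    fix j assume "j \<in> UNIV - {i}"
    then show "(2 * real n + 1) * (\<integral>A. (A $ i \<bullet> v) ^ (2 * n) * (A $ j \<bullet> v)\<^sup>2 \<partial>H) = row_moment (2 * Suc n) i v"
      using row_mixed_moment[of i j n v] by (simp add: add.commute)
  qed
  also have "\<dots> = (real CARD('d) - 1) * row_moment (2 * Suc n) i v"
    by (simp add: card_Diff_singleton of_nat_diff Suc_leI)
  finally have 1: "(2 * real n + 1) * S = (real CARD('d) - 1) * row_moment (2 * Suc n) i v" .
  have "S = (\<integral>A. (\<Sum>j\<in>UNIV - {i}. (A $ i \<bullet> v) ^ (2 * n) * (A $ j \<bullet> v)\<^sup>2) \<partial>H)"
    unfolding S_def by (rule Bochner_Integration.integral_sum[symmetric]) (rule integrable_row_inner_powers)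
  also have "\<dots> = (\<integral>A. (norm v)\<^sup>2 * (A $ i \<bullet> v) ^ (2 * n) - (A $ i \<bullet> v) ^ (2 * Suc n) \<partial>H)"
  proof (rule integral_cong_AE)
    show "AE A in H. (\<Sum>j\<in>UNIV - {i}. (A $ i \<bullet> v) ^ (2 * n) * (A $ j \<bullet> v)\<^sup>2)
        = (norm v)\<^sup>2 * (A $ i \<bullet> v) ^ (2 * n) - (A $ i \<bullet> v) ^ (2 * Suc n)"
      using AE_norm[of v]
    proof eventually_elim
      case (elim A)
      have "(\<Sum>j\<in>UNIV. (A $ j \<bullet> v)\<^sup>2) = (norm (A *v v))\<^sup>2"
        unfolding power2_norm_eq_inner inner_vec_def[of "A *v v"]
        by (simp add: matrix_vector_mul_component power2_eq_square)
      then have "(\<Sum>j\<in>UNIV - {i}. (A $ j \<bullet> v)\<^sup>2) = (norm v)\<^sup>2 - (A $ i \<bullet> v)\<^sup>2"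
        using elim by (simp add: sum_diff1)
      then show ?case
        unfolding sum_distrib_left[symmetric]
        by (simp add: right_diff_distrib power2_eq_square mult_ac)
    qed
  qed measurable
  also have "\<dots> = (norm v)\<^sup>2 * row_moment (2 * n) i v - row_moment (2 * Suc n) i v"
    unfolding row_moment_def
    by (subst Bochner_Integration.integral_diff) (auto intro: integrable_row_inner_power simp del: mult_Suc_right)
  finally have "S = (norm v)\<^sup>2 * row_moment (2 * n) i v - row_moment (2 * Suc n) i v" .
  from 1[unfolded this] show ?thesis by (simp add: algebra_simps)
qed

text \<open>The factor (2n+1)/(d+2n) of the recursion is the ratio of the next factors of the two
  Pochhammer symbols, 1/2 + n and d/2 + n.\<close>

lemma row_moment_eq:
  "row_moment (2 * n) i v = (norm v)\<^sup>2 ^ n * pochhammer (1 / 2) n / pochhammer (real CARD('d) / 2) n"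
proof (induction n)
  case 0
  then show ?case by (simp add: row_moment_def prob_space)
next
  case (Suc n)
  have "row_moment (2 * Suc n) i v =
      (2 * real n + 1) * (norm v)\<^sup>2 * row_moment (2 * n) i v / (real CARD('d) + 2 * real n)"
    using row_moment_Suc[of n i v] by (intro eq_divide_imp) (auto simp: mult.commute add_nonneg_eq_0_iff)
  moreover have "(2 * real n + 1) / (real CARD('d) + 2 * real n) = (1 / 2 + real n) / (real CARD('d) / 2 + real n)"
    using mult_divide_mult_cancel_left[of 2 "1 / 2 + real n" "real CARD('d) / 2 + real n"]
    by (simp add: algebra_simps)
  ultimately have "row_moment (2 * Suc n) i v =
      (1 / 2 + real n) / (real CARD('d) / 2 + real n) * ((norm v)\<^sup>2 * row_moment (2 * n) i v)"
    by (simp only: times_divide_eq_left[symmetric] mult.assoc)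
  then show ?case
    unfolding Suc pochhammer_Suc by (simp add: mult_ac)
qed

end

section \<open>Mean squared errors\<close>

text \<open>Serves both estimators. Expanding the square involves only means and pairwise second
  moments, so no independence is assumed and the difference of the errors will come from
  \<open>r\<close> alone.\<close>

lemma (in prob_space) mean_square_error_average:
  fixes X :: "'i \<Rightarrow> 'a \<Rightarrow> real"
  assumes I: "finite I" "I \<noteq> {}"
    and meas [measurable]: "\<And>i. i \<in> I \<Longrightarrow> X i \<in> borel_measurable M"
    and bnd: "\<And>i w. i \<in> I \<Longrightarrow> \<bar>X i w\<bar> \<le> 1"
    and mean: "\<And>i. i \<in> I \<Longrightarrow> expectation (X i) = \<mu>"
    and sq: "\<And>i. i \<in> I \<Longrightarrow> expectation (\<lambda>w. X i w * X i w) = q"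
    and cross: "\<And>i j. i \<in> I \<Longrightarrow> j \<in> I \<Longrightarrow> i \<noteq> j \<Longrightarrow> expectation (\<lambda>w. X i w * X j w) = r"
  shows "expectation (\<lambda>w. (1 / real (card I) * (\<Sum>i\<in>I. X i w) - e)\<^sup>2)
    = (q + (real (card I) - 1) * r) / real (card I) - 2 * e * \<mu> + e\<^sup>2"
proof -
  define m where "m = real (card I)"
  have m: "m > 0" using I by (simp add: m_def card_gt_0_iff)
  have i1: "integrable M (X i)" if "i \<in> I" for i
    using that bnd by (intro integrable_const_bound[of _ 1]) auto
  have i2: "integrable M (\<lambda>w. X i w * X j w)" if "i \<in> I" "j \<in> I" for i j
    using that bnd mult_mono[OF bnd bnd] by (intro integrable_const_bound[of _ 1]) (auto simp: abs_mult)
  have row: "(\<Sum>j\<in>I. expectation (\<lambda>w. X i w * X j w)) = q + (m - 1) * r" if i: "i \<in> I" for i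
  proof -
    have "(\<Sum>j\<in>I - {i}. expectation (\<lambda>w. X i w * X j w)) = (\<Sum>j\<in>I - {i}. r)"
      by (rule sum.cong) (use i in \<open>auto intro!: cross\<close>)
    then have "(\<Sum>j\<in>I. expectation (\<lambda>w. X i w * X j w)) = q + (\<Sum>j\<in>I - {i}. r)"
      using I i by (subst sum.remove[of _ i]) (simp_all add: sq)
    then show ?thesis using I i by (simp add: m_def of_nat_diff Suc_leI card_gt_0_iff)
  qed
  have "(1 / m * (\<Sum>i\<in>I. X i w) - e)\<^sup>2
     = (1 / m\<^sup>2) * (\<Sum>i\<in>I. \<Sum>j\<in>I. X i w * X j w) - (2 * e / m) * (\<Sum>i\<in>I. X i w) + e\<^sup>2" for w
    by (simp add: power2_diff power_mult_distrib power_divide power2_eq_square[of "sum _ _"] sum_product field_simps)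
  then have "expectation (\<lambda>w. (1 / m * (\<Sum>i\<in>I. X i w) - e)\<^sup>2)
     = (1 / m\<^sup>2) * (\<Sum>i\<in>I. \<Sum>j\<in>I. expectation (\<lambda>w. X i w * X j w))
       - (2 * e / m) * (\<Sum>i\<in>I. expectation (X i)) + e\<^sup>2"
    using i1 i2 by (simp add: prob_space)
  also have "\<dots> = (1 / m\<^sup>2) * (m * (q + (m - 1) * r)) - (2 * e / m) * (m * \<mu>) + e\<^sup>2"
    by (simp add: row mean m_def)
  also have "\<dots> = (q + (m - 1) * r) / m - 2 * e * \<mu> + e\<^sup>2"
    using m by (simp add: power2_eq_square)
  finally show ?thesis unfolding m_def .
qed

lemma has_bochner_integral_PiM_component:
  fixes f :: "'a \<Rightarrow> real"
  assumes "prob_space N" "i \<in> I" and f: "has_bochner_integral N f a"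
  shows "has_bochner_integral (PiM I (\<lambda>_. N)) (\<lambda>w. f (w i)) a"
proof -
  interpret N: prob_space N by fact
  interpret product_prob_space "\<lambda>_. N" I ..
  have "distr (PiM I (\<lambda>_. N)) N (\<lambda>w. w i) = N"
    using PiM_component[OF \<open>i \<in> I\<close>] by simp
  with f have "has_bochner_integral (distr (PiM I (\<lambda>_. N)) N (\<lambda>w. w i)) f a" by simp
  then show ?thesis
    using f \<open>i \<in> I\<close> by (auto simp: has_bochner_integral_iff integrable_distr_eq integral_distr)
qed

lemma has_bochner_integral_PiM_pair:
  fixes f g :: "'a \<Rightarrow> real"
  assumes N: "prob_space N" and I: "finite I" "i \<in> I" "j \<in> I" "i \<noteq> j"
    and f: "has_bochner_integral N f a" and g: "has_bochner_integral N g b"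
  shows "has_bochner_integral (PiM I (\<lambda>_. N)) (\<lambda>w. f (w i) * g (w j)) (a * b)"
proof -
  interpret N: prob_space N by fact
  interpret product_sigma_finite "\<lambda>_. N" ..
  define F where "F k = (if k = i then f else if k = j then g else (\<lambda>_. 1))" for k
  have iF: "integrable N (F k)" for k
    using f g by (auto simp: F_def has_bochner_integral_iff)
  have split: "(\<Prod>k\<in>I. h k) = h i * h j"
    if "\<And>k. k \<noteq> i \<Longrightarrow> k \<noteq> j \<Longrightarrow> h k = 1" for h :: "_ \<Rightarrow> real"
  proof -
    have "(\<Prod>k\<in>I. h k) = (\<Prod>k\<in>{i, j}. h k)"
      using I that by (intro prod.mono_neutral_right) auto
    then show ?thesis using I by simp
  qed
  \<comment> \<open>Padding the remaining coordinates with the constant 1 makes the integrand a full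
    product over \<open>I\<close>.\<close>
  have "has_bochner_integral (PiM I (\<lambda>_. N)) (\<lambda>w. \<Prod>k\<in>I. F k (w k)) (\<Prod>k\<in>I. integral\<^sup>L N (F k))"
    unfolding has_bochner_integral_iff
    using product_integrable_prod[of I F] product_integral_prod[of I F] iF I by auto
  moreover have "(\<Prod>k\<in>I. F k (w k)) = f (w i) * g (w j)" for w
    using I by (subst split) (auto simp: F_def)
  moreover have "(\<Prod>k\<in>I. integral\<^sup>L N (F k)) = a * b"
    using I f g by (subst split) (auto simp: F_def has_bochner_integral_iff N.prob_space)
  ultimately show ?thesis by simp
qed

text \<open>The sum of two independent chi-squared variables with \<open>k\<close> degrees of
  freedom has 2k of them. At the level of moments this is the Vandermonde identity for Pochhammer
  symbols, with k/2 + k/2 = k.\<close>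

lemma chi_pair_moment:
  assumes "k > 0" "finite I" "i \<in> I" "j \<in> I" "i \<noteq> j"
  shows "has_bochner_integral (PiM I (\<lambda>_. chi_measure k)) (\<lambda>s. ((s i)\<^sup>2 + (s j)\<^sup>2) ^ n)
    (2 ^ n * pochhammer (real k) n)"
proof -
  have "has_bochner_integral (PiM I (\<lambda>_. chi_measure k))
     (\<lambda>s. \<Sum>l\<le>n. real (n choose l) * (s i ^ (2 * l) * s j ^ (2 * (n - l))))
     (\<Sum>l\<le>n. real (n choose l) * ((2 ^ l * pochhammer (real k / 2) l) * (2 ^ (n - l) * pochhammer (real k / 2) (n - l))))"
    by (intro has_bochner_integral_sum has_bochner_integral_mult_right has_bochner_integral_PiM_pair
        prob_space_chi_measure chi_moment assms)
  moreover have "(\<Sum>l\<le>n. real (n choose l) * (s i ^ (2 * l) * s j ^ (2 * (n - l)))) = ((s i)\<^sup>2 + (s j)\<^sup>2) ^ n"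
    for s :: "_ \<Rightarrow> real"
    by (simp add: binomial_ring power_mult mult.assoc)
  moreover have "(\<Sum>l\<le>n. real (n choose l) * ((2 ^ l * pochhammer (real k / 2) l) * (2 ^ (n - l) * pochhammer (real k / 2) (n - l))))
     = 2 ^ n * pochhammer (real k) n"
  proof -
    have "(\<Sum>l\<le>n. real (n choose l) * ((2 ^ l * pochhammer (real k / 2) l) * (2 ^ (n - l) * pochhammer (real k / 2) (n - l))))
      = (\<Sum>l\<le>n. 2 ^ n * (real (n choose l) * pochhammer (real k / 2) l * pochhammer (real k / 2) (n - l)))"
    proof (intro sum.cong refl)
      fix l assume "l \<in> {..n}"
      then have "(2::real) ^ n = 2 ^ l * 2 ^ (n - l)" by (simp flip: power_add)
      then show "real (n choose l) * ((2 ^ l * pochhammer (real k / 2) l) * (2 ^ (n - l) * pochhammer (real k / 2) (n - l)))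
        = 2 ^ n * (real (n choose l) * pochhammer (real k / 2) l * pochhammer (real k / 2) (n - l))"
        by (simp add: mult_ac)
    qed
    also have "\<dots> = 2 ^ n * pochhammer (real k / 2 + real k / 2) n"
      unfolding pochhammer_binomial_sum sum_distrib_left by simp
    finally show ?thesis by simp
  qed
  ultimately show ?thesis by simp
qed

section \<open>Cosine expectations under the ORF model\<close>

context haar
begin

lemma integrable_combination_power:
  "integrable H (\<lambda>A. (a * (A $ i \<bullet> v) + b * (A $ j \<bullet> v)) ^ n)"
proof (rule integrable_const_bound)
  show "AE A in H. norm ((a * (A $ i \<bullet> v) + b * (A $ j \<bullet> v)) ^ n) \<le> (\<bar>a\<bar> * norm v + \<bar>b\<bar> * norm v) ^ n"
    using AE_row_inner_le[of i v] AE_row_inner_le[of j v]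
  proof eventually_elim
    case (elim A)
    have "\<bar>a * (A $ i \<bullet> v) + b * (A $ j \<bullet> v)\<bar> \<le> \<bar>a * (A $ i \<bullet> v)\<bar> + \<bar>b * (A $ j \<bullet> v)\<bar>"
      by (rule abs_triangle_ineq)
    also have "\<dots> \<le> \<bar>a\<bar> * norm v + \<bar>b\<bar> * norm v"
      unfolding abs_mult by (intro add_mono mult_left_mono elim) auto
    finally show ?case by (auto simp: power_abs intro!: power_mono)
  qed
qed measurable

text \<open>Even powers are nonnegative, so Tonelli gives integrability and value together: for
  fixed \<open>s\<close> the inner integral is \<open>row_moment_combination\<close>, and
  \<open>K\<close> is the outer one. Leaving the weights \<open>a\<close> and \<open>b\<close>
  general covers a single row as well as sums and differences of two rows.\<close>

lemma has_bochner_integral_combination: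
  assumes P: "prob_space P" and "i \<noteq> j"
    and [measurable]: "a \<in> borel_measurable P" "b \<in> borel_measurable P"
    and K: "has_bochner_integral P (\<lambda>s. ((a s)\<^sup>2 + (b s)\<^sup>2) ^ n) K"
  shows "has_bochner_integral (P \<Otimes>\<^sub>M H)
     (\<lambda>p. (a (fst p) * (snd p $ i \<bullet> v) + b (fst p) * (snd p $ j \<bullet> v)) ^ (2 * n)) (K * row_moment (2 * n) i v)"
proof (rule has_bochner_integral_nn_integral)
  interpret P: prob_space P by fact
  have c: "row_moment (2 * n) i v \<ge> 0"
    unfolding row_moment_def by (intro Bochner_Integration.integral_nonneg) (simp add: power_mult)
  have "K \<ge> 0"
    using Bochner_Integration.integral_nonneg[of P "\<lambda>s. ((a s)\<^sup>2 + (b s)\<^sup>2) ^ n"] K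
    by (simp add: has_bochner_integral_integral_eq)
  then show "0 \<le> K * row_moment (2 * n) i v" using c by simp
  show m: "(\<lambda>p. (a (fst p) * (snd p $ i \<bullet> v) + b (fst p) * (snd p $ j \<bullet> v)) ^ (2 * n)) \<in> borel_measurable (P \<Otimes>\<^sub>M H)"
    by measurable
  show "AE p in P \<Otimes>\<^sub>M H. 0 \<le> (a (fst p) * (snd p $ i \<bullet> v) + b (fst p) * (snd p $ j \<bullet> v)) ^ (2 * n)"
    by (simp add: power_mult)
  have "(\<integral>\<^sup>+p. ennreal ((a (fst p) * (snd p $ i \<bullet> v) + b (fst p) * (snd p $ j \<bullet> v)) ^ (2 * n)) \<partial>(P \<Otimes>\<^sub>M H))
    = (\<integral>\<^sup>+s. \<integral>\<^sup>+A. ennreal ((a s * (A $ i \<bullet> v) + b s * (A $ j \<bullet> v)) ^ (2 * n)) \<partial>H \<partial>P)"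
    using m by (subst nn_integral_fst[symmetric]) auto
  also have "\<dots> = (\<integral>\<^sup>+s. ennreal (((a s)\<^sup>2 + (b s)\<^sup>2) ^ n * row_moment (2 * n) i v) \<partial>P)"
  proof (intro nn_integral_cong)
    fix s
    show "(\<integral>\<^sup>+A. ennreal ((a s * (A $ i \<bullet> v) + b s * (A $ j \<bullet> v)) ^ (2 * n)) \<partial>H)
        = ennreal (((a s)\<^sup>2 + (b s)\<^sup>2) ^ n * row_moment (2 * n) i v)"
      by (subst nn_integral_eq_integral[OF integrable_combination_power])
         (simp_all only: row_moment_combination[OF \<open>i \<noteq> j\<close>, where k = i], simp add: power_mult)
  qed
  also have "\<dots> = ennreal (K * row_moment (2 * n) i v)"
    using has_bochner_integral_mult_left[OF K, of "row_moment (2 * n) i v"] c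
    by (subst nn_integral_eq_integral) (auto simp: has_bochner_integral_iff)
  finally show "(\<integral>\<^sup>+p. ennreal ((a (fst p) * (snd p $ i \<bullet> v) + b (fst p) * (snd p $ j \<bullet> v)) ^ (2 * n)) \<partial>(P \<Otimes>\<^sub>M H))
    = ennreal (K * row_moment (2 * n) i v)" .
qed

abbreviation orf_space :: "(('d \<Rightarrow> real) \<times> (real ^ 'd ^ 'd)) measure" where
  "orf_space \<equiv> PiM UNIV (\<lambda>_. chi_measure CARD('d)) \<Otimes>\<^sub>M H"

lemma prob_space_chi_product: "prob_space (PiM UNIV (\<lambda>_::'d. chi_measure CARD('d)))"
  by (intro prob_space_PiM prob_space_chi_measure) simp

text \<open>The Pochhammer symbol at d/2 in the chi moment cancels the one in the row moment. What
  remains are the moments of a Gaussian of variance |v|^2, whose cosine series is the exponential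
  series.\<close>

lemma expectation_cos_row:
  assumes "i \<noteq> j"
  shows "(\<integral>p. cos (fst p i * (snd p $ i \<bullet> v)) \<partial>orf_space) = exp (- (norm v)\<^sup>2 / 2)"
proof -
  let ?h = "real CARD('d) / 2"
  define \<mu> where "\<mu> n = (2 ^ n * pochhammer ?h n) * row_moment (2 * n) i v" for n
  have pos: "pochhammer ?h n > 0" "pochhammer (1 / 2 :: real) n > 0" for n
    by (simp_all add: pochhammer_pos)
  have moment_over_fact: "\<mu> n / fact (2 * n) = ((norm v)\<^sup>2 / 2) ^ n / fact n" for n
    using pos[of n] unfolding \<mu>_def row_moment_eq fact_double[of n, where 'a = real]
    unfolding mult_2[of n] power_add
    by (simp add: power_divide field_simps)
  have sm: "summable (\<lambda>n. x ^ n / fact n)" for x :: real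
    using summable_exp[of x] by (simp add: field_simps)
  have mom: "has_bochner_integral orf_space (\<lambda>p. (fst p i * (snd p $ i \<bullet> v)) ^ (2 * n)) (\<mu> n)" for n
  proof -
    have "has_bochner_integral (PiM UNIV (\<lambda>_. chi_measure CARD('d))) (\<lambda>s. s i ^ (2 * n)) (2 ^ n * pochhammer ?h n)"
      by (intro has_bochner_integral_PiM_component[where f = "\<lambda>t. t ^ (2 * n)"] prob_space_chi_measure chi_moment)
         simp_all
    \<comment> \<open>A single row is the degenerate combination in which the second weight is
      0.\<close>
    then show ?thesis
      unfolding \<mu>_def
      using has_bochner_integral_combination[OF prob_space_chi_product assms,
          where a = "\<lambda>s. s i" and b = "\<lambda>_. 0" and n = n]
      by (simp add: power_mult)
  qed
  have "(\<lambda>n. (- 1) ^ n * \<mu> n / fact (2 * n)) sums (\<integral>p. cos (fst p i * (snd p $ i \<bullet> v)) \<partial>orf_space)"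
    by (rule expectation_cos_sums[OF mom]) (simp add: moment_over_fact sm)
  moreover have "(- 1) ^ n * \<mu> n / fact (2 * n) = (- (norm v)\<^sup>2 / 2) ^ n /\<^sub>R fact n" for n
  proof -
    have neg: "(- (norm v)\<^sup>2 / 2) ^ n = (- 1) ^ n * ((norm v)\<^sup>2 / 2) ^ n"
      using power_minus[of "(norm v)\<^sup>2 / 2" n] by simp
    have "(- 1) ^ n * \<mu> n / fact (2 * n) = (- 1) ^ n * (((norm v)\<^sup>2 / 2) ^ n / fact n)"
      by (simp only: moment_over_fact times_divide_eq_right[symmetric])
    then show ?thesis unfolding neg real_scaleR_def by (simp only: divide_inverse_commute mult.left_commute)
  qed
  ultimately have "(\<lambda>n. (- (norm v)\<^sup>2 / 2) ^ n /\<^sub>R fact n) sums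
      (\<integral>p. cos (fst p i * (snd p $ i \<bullet> v)) \<partial>orf_space)" by simp
  then show ?thesis
    using exp_converges[of "- (norm v)\<^sup>2 / 2"] sums_unique2 by blast
qed

text \<open>The product of cosines is half the sum of the cosines of s_i u_i + s_j u_j and s_i u_i -
  s_j u_j. The even moments depend on the weights only through their squares, so both cosines have
  the same expectation, given by one series.\<close>

lemma cos_pair_sums:
  assumes "i \<noteq> j"
  shows "(\<lambda>n. (- (norm v)\<^sup>2) ^ n / (2 ^ n * fact n) * (pochhammer (real CARD('d)) n / pochhammer (real CARD('d) / 2) n))
    sums (\<integral>p. cos (fst p i * (snd p $ i \<bullet> v)) * cos (fst p j * (snd p $ j \<bullet> v)) \<partial>orf_space)"
proof -
  let ?h = "real CARD('d) / 2"
  interpret P: prob_space "PiM UNIV (\<lambda>_::'d. chi_measure CARD('d))" by (rule prob_space_chi_product)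
  interpret PH: pair_prob_space "PiM UNIV (\<lambda>_::'d. chi_measure CARD('d))" H ..
  define \<mu> where "\<mu> n = (2 ^ n * pochhammer (real CARD('d)) n) * row_moment (2 * n) i v" for n
  define t where "t n = (norm v)\<^sup>2 ^ n / (2 ^ n * fact n) * (pochhammer (real CARD('d)) n / pochhammer ?h n)" for n
  have pos: "pochhammer ?h n > 0" "pochhammer (1 / 2 :: real) n > 0" "pochhammer (real CARD('d)) n > 0" for n
    by (simp_all add: pochhammer_pos)
  have moment_over_fact: "\<mu> n / fact (2 * n) = t n" for n
    using pos[of n] unfolding \<mu>_def t_def row_moment_eq fact_double[of n, where 'a = real]
    unfolding mult_2[of n] power_add
    by (simp add: field_simps)
  \<comment> \<open>Factor by factor, d + l is at most 2(d/2 + l). The quotient of the symbols is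
    then at most 2^n, and the series is dominated by that of exp(|v|^2).\<close>
  have "pochhammer (real CARD('d)) n \<le> 2 ^ n * pochhammer ?h n" for n
  proof (induction n)
    case (Suc n)
    have "pochhammer (real CARD('d)) n * (real CARD('d) + real n)
        \<le> (2 ^ n * pochhammer ?h n) * (2 * (?h + real n))"
      using Suc pos[of n] by (intro mult_mono) auto
    also have "\<dots> = 2 ^ Suc n * (pochhammer ?h n * (?h + real n))"
      by (simp only: power_Suc mult_ac)
    finally show ?case by (simp only: pochhammer_Suc)
  qed simp
  then have le: "pochhammer (real CARD('d)) n / pochhammer ?h n \<le> 2 ^ n" for n
    using pos[of n] by (simp add: divide_le_eq)
  have "summable t"
  proof (rule summable_comparison_test')
    show "summable (\<lambda>n. (norm v)\<^sup>2 ^ n / fact n)"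
      using summable_exp[of "(norm v)\<^sup>2"] by (simp add: field_simps)
    fix n :: nat
    have "t n \<le> (norm v)\<^sup>2 ^ n / (2 ^ n * fact n) * 2 ^ n"
      unfolding t_def by (intro mult_left_mono le) auto
    moreover have "t n \<ge> 0" using pos[of n] unfolding t_def by simp
    ultimately show "norm (t n) \<le> (norm v)\<^sup>2 ^ n / fact n" by simp
  qed
  then have sm: "summable (\<lambda>n. \<mu> n / fact (2 * n))" by (simp add: moment_over_fact)
  \<comment> \<open>The sign \<open>c\<close>, later 1 or -1, is absorbed into the weight of the
    second row so that sum and difference are handled together.\<close>
  define X where "X c p = fst p i * (snd p $ i \<bullet> v) + (c * fst p j) * (snd p $ j \<bullet> v)" for c p
  have [measurable]: "X c \<in> borel_measurable orf_space" for c
    unfolding X_def by measurable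
  have mom: "has_bochner_integral orf_space (\<lambda>p. X c p ^ (2 * n)) (\<mu> n)" if "c\<^sup>2 = 1" for c n
    unfolding \<mu>_def X_def
    using has_bochner_integral_combination[OF prob_space_chi_product assms,
        where a = "\<lambda>s. s i" and b = "\<lambda>s. c * s j" and n = n]
      chi_pair_moment[of "CARD('d)" UNIV i j n] assms that
    by (simp add: power_mult_distrib)
  have S: "(\<lambda>n. (- 1) ^ n * \<mu> n / fact (2 * n)) sums (\<integral>p. cos (X c p) \<partial>orf_space)" if "c\<^sup>2 = 1" for c
    using mom[OF that] sm by (rule expectation_cos_sums)
  have int: "integrable orf_space (\<lambda>p. cos (X c p))" for c
    by (rule PH.P.integrable_const_bound[of _ 1]) auto
  have product: "cos (fst p i * (snd p $ i \<bullet> v)) * cos (fst p j * (snd p $ j \<bullet> v)) = (cos (X 1 p) + cos (X (-1) p)) / 2" for p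
    unfolding X_def by (simp add: cos_add cos_diff)
  have "(\<integral>p. cos (fst p i * (snd p $ i \<bullet> v)) * cos (fst p j * (snd p $ j \<bullet> v)) \<partial>orf_space)
     = ((\<integral>p. cos (X 1 p) \<partial>orf_space) + (\<integral>p. cos (X (-1) p) \<partial>orf_space)) / 2"
    unfolding product using int by simp
  also have "(\<integral>p. cos (X (-1) p) \<partial>orf_space) = (\<integral>p. cos (X 1 p) \<partial>orf_space)"
    using S[of "-1"] S[of 1] by (auto intro: sums_unique2)
  finally have "(\<lambda>n. (- 1) ^ n * \<mu> n / fact (2 * n)) sums
      (\<integral>p. cos (fst p i * (snd p $ i \<bullet> v)) * cos (fst p j * (snd p $ j \<bullet> v)) \<partial>orf_space)"
    using S[of 1] by simp
  moreover have "(- 1) ^ n * \<mu> n / fact (2 * n)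
      = (- (norm v)\<^sup>2) ^ n / (2 ^ n * fact n) * (pochhammer (real CARD('d)) n / pochhammer ?h n)" for n
  proof -
    have "(- (norm v)\<^sup>2) ^ n = (- 1) ^ n * (norm v)\<^sup>2 ^ n" by (rule power_minus)
    moreover have "(- 1) ^ n * \<mu> n / fact (2 * n) = (- 1) ^ n * t n"
      by (simp only: moment_over_fact times_divide_eq_right[symmetric])
    ultimately show ?thesis unfolding t_def by simp
  qed
  ultimately show ?thesis by simp
qed

text \<open>Writing both Pochhammer symbols as Gamma quotients splits off the constant
  Gamma(d/2)/Gamma(d) from every term.\<close>

lemma expectation_cos_rows:
  assumes "i \<noteq> j"
  shows "(\<integral>p. cos (fst p i * (snd p $ i \<bullet> v)) * cos (fst p j * (snd p $ j \<bullet> v)) \<partial>orf_space) =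
    Gamma (real CARD('d) / 2) / Gamma (real CARD('d)) *
      (\<Sum>k. (- (norm v)\<^sup>2) ^ k / (2 ^ k * fact k) *
         (Gamma (real k + real CARD('d)) / Gamma (real k + real CARD('d) / 2)))"
proof -
  let ?d = "real CARD('d)"
  define c where "c = Gamma (?d / 2) / Gamma ?d"
  define f where "f k = (- (norm v)\<^sup>2) ^ k / (2 ^ k * fact k) * (Gamma (real k + ?d) / Gamma (real k + ?d / 2))" for k
  have c: "c > 0" by (simp add: c_def Gamma_real_pos)
  have p: "pochhammer z n = Gamma (real n + z) / Gamma z" if "z > 0" for z :: real and n
    using pochhammer_Gamma[of z n] that nonpos_Ints_nonpos[of z] by (force simp: add.commute)
  have "(- (norm v)\<^sup>2) ^ k / (2 ^ k * fact k) * (pochhammer ?d k / pochhammer (?d / 2) k) = c * f k" for k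
    by (simp add: p c_def f_def mult_ac)
  then have "(\<lambda>k. c * f k) sums
      (\<integral>p. cos (fst p i * (snd p $ i \<bullet> v)) * cos (fst p j * (snd p $ j \<bullet> v)) \<partial>orf_space)"
    using cos_pair_sums[OF assms, of v] by simp
  \<comment> \<open>Since \<open>c\<close> is nonzero, summability passes from the scaled series to
    \<open>f\<close>, so the constant may leave the sum.\<close>
  then have "c * suminf f = (\<integral>p. cos (fst p i * (snd p $ i \<bullet> v)) * cos (fst p j * (snd p $ j \<bullet> v)) \<partial>orf_space)"
    using c suminf_mult[of f c] by (simp add: sums_iff summable_cmult_iff)
  then show ?thesis unfolding c_def f_def[abs_def] by (rule sym)
qed

end

section \<open>Comparison of the IIDRF and ORF errors\<close>

theorem theorem4p5:
  fixes x y :: "real ^ 'd" and H :: "(real ^ 'd ^ 'd) measure" and I :: "'d set" and m :: nat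
  assumes "CARD('d) \<ge> 2"
    and "2 \<le> m" and "m \<le> CARD('d)"
    and "card I = m"
    and "haar_orthogonal H"
  shows "mse_iid I x y - mse_orf H I x y =
    (real m - 1) / real m *
      (exp (- (norm (x - y))\<^sup>2) -
       Gamma (real CARD('d) / 2) / Gamma (real CARD('d)) *
       (\<Sum>k. (- (norm (x - y))\<^sup>2) ^ k / (2 ^ k * fact k) *
             (Gamma (real k + real CARD('d)) / Gamma (real k + real CARD('d) / 2))))"
proof -
  define v where "v = x - y"
  define e where "e = exp (- (norm v)\<^sup>2 / 2)"
  \<comment> \<open>By the double-angle formula the second moment of one cosine feature is governed
    by the expected cosine at 2v, so it is the same for both schemes.\<close>
  define q where "q = (1 + exp (- (norm (2 *\<^sub>R v))\<^sup>2 / 2)) / 2"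
  define r where "r = Gamma (real CARD('d) / 2) / Gamma (real CARD('d)) *
       (\<Sum>k. (- (norm v)\<^sup>2) ^ k / (2 ^ k * fact k) *
             (Gamma (real k + real CARD('d)) / Gamma (real k + real CARD('d) / 2)))"
  have I: "finite I" "I \<noteq> {}" using assms by auto
  have cos_sq: "cos t * cos t = (1 + cos (2 * t)) / 2" for t :: real
    using cos_double_cos[of t] by (simp add: power2_eq_square)
  interpret haar H by standard fact

  define G where "G = PiM I (\<lambda>_. std_gauss_vec :: (real ^ 'd) measure)"
  interpret G: prob_space G unfolding G_def by (intro prob_space_PiM prob_space_std_gauss_vec)
  have gmeas: "(\<lambda>w. cos (w i \<bullet> v)) \<in> borel_measurable G" if "i \<in> I" for i
  proof -
    have "(\<lambda>g. cos (g \<bullet> v)) \<in> borel_measurable (std_gauss_vec :: (real ^ 'd) measure)"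
      using has_bochner_integral_cos_std_gauss_vec by (rule borel_measurable_has_bochner_integral)
    then show ?thesis unfolding G_def using that by measurable
  qed
  \<comment> \<open>Here \<open>e\<close> is both the target and the mean of each feature;
    independence makes the cross moment \<open>e * e\<close>.\<close>
  have "mse_iid I x y = (q + (real (card I) - 1) * (e * e)) / real (card I) - 2 * e * e + e\<^sup>2"
    unfolding mse_iid_def rff_est_def v_def[symmetric] e_def[symmetric] G_def[symmetric]
  proof (rule G.mean_square_error_average[OF I gmeas])
    fix i assume i: "i \<in> I"
    have c: "has_bochner_integral G (\<lambda>w. cos (w i \<bullet> u)) (exp (- (norm u)\<^sup>2 / 2))" for u
      unfolding G_def using i
      by (rule has_bochner_integral_PiM_component[OF prob_space_std_gauss_vec _ has_bochner_integral_cos_std_gauss_vec])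
    show "G.expectation (\<lambda>w. cos (w i \<bullet> v)) = e"
      using c[of v] by (simp add: has_bochner_integral_iff e_def)
    show "G.expectation (\<lambda>w. cos (w i \<bullet> v) * cos (w i \<bullet> v)) = q"
      using c[of "2 *\<^sub>R v"] by (simp add: has_bochner_integral_iff q_def cos_sq G.prob_space)
    fix j assume "j \<in> I" "i \<noteq> j"
    then have "has_bochner_integral G (\<lambda>w. cos (w i \<bullet> v) * cos (w j \<bullet> v)) (e * e)"
      unfolding G_def e_def using i I
      by (intro has_bochner_integral_PiM_pair[OF prob_space_std_gauss_vec _ _ _ _
            has_bochner_integral_cos_std_gauss_vec has_bochner_integral_cos_std_gauss_vec])
    then show "G.expectation (\<lambda>w. cos (w i \<bullet> v) * cos (w j \<bullet> v)) = e * e"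
      by (rule has_bochner_integral_integral_eq)
  qed simp_all

  moreover have "mse_orf H I x y = (q + (real (card I) - 1) * r) / real (card I) - 2 * e * e + e\<^sup>2"
  proof -
    interpret P: prob_space "PiM UNIV (\<lambda>_::'d. chi_measure CARD('d))" by (rule prob_space_chi_product)
    interpret PH: pair_prob_space "PiM UNIV (\<lambda>_::'d. chi_measure CARD('d))" H ..
    \<comment> \<open>Supplies the second row index for \<open>expectation_cos_row\<close>; it
      exists because the dimension is at least 2.\<close>
    have other: "\<exists>j. i \<noteq> j" for i :: 'd
    proof (rule ccontr)
      assume "\<nexists>j. i \<noteq> j"
      then have "UNIV = {i}" by auto
      then have "CARD('d) = card {i}" by simp
      with assms(1) show False by simp
    qed
    show ?thesis
      unfolding mse_orf_def rff_est_def v_def[symmetric] e_def[symmetric] inner_scaleR_left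
    proof (rule PH.P.mean_square_error_average[OF I])
      fix i assume "i \<in> I"
      obtain k where k: "i \<noteq> k" using other by blast
      show "(\<lambda>p. cos (fst p i * (snd p $ i \<bullet> v))) \<in> borel_measurable orf_space"
        by measurable
      then have int: "integrable orf_space (\<lambda>p. cos (fst p i * (snd p $ i \<bullet> u)))" for u
        by (intro PH.P.integrable_const_bound[of _ 1]) auto
      show "PH.P.expectation (\<lambda>p. cos (fst p i * (snd p $ i \<bullet> v))) = e"
        unfolding e_def using k by (rule expectation_cos_row)
      show "PH.P.expectation (\<lambda>p. cos (fst p i * (snd p $ i \<bullet> v)) * cos (fst p i * (snd p $ i \<bullet> v))) = q"
        using expectation_cos_row[OF k, of "2 *\<^sub>R v"] int[of "2 *\<^sub>R v"]
        by (simp add: q_def cos_sq PH.P.prob_space mult_ac)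
      fix j assume "i \<noteq> j"
      show "PH.P.expectation (\<lambda>p. cos (fst p i * (snd p $ i \<bullet> v)) * cos (fst p j * (snd p $ j \<bullet> v))) = r"
        unfolding r_def using \<open>i \<noteq> j\<close> by (rule expectation_cos_rows)
    qed simp_all
  qed
  \<comment> \<open>The terms in \<open>q\<close> and the bias terms cancel, leaving only the cross
    moments.\<close>
  ultimately have "mse_iid I x y - mse_orf H I x y = (real m - 1) / real m * (e * e - r)"
    using assms(4) by (simp add: add_divide_distrib right_diff_distrib)
  moreover have "e * e = exp (- (norm (x - y))\<^sup>2)"
    unfolding e_def v_def by (simp flip: exp_add)
  ultimately show ?thesis unfolding r_def v_def by simp
qed

end
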